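(* Each $\mathcal L_\Box^\mu$-formula $\varphi$ is equivalent to $\varphi^t$ in every topological space; that is, for every topological space $X$, every assignment $h$ into $X$ and every $x\in X$, $(X,h),x\models\varphi$ iff $(X,h),x\models\varphi^t$.
   Context: $\mathsf{Var}$ is an infinite set of propositional variables (atoms). $\mathcal L_\Box^\mu$-formulas: atoms; $\top$; $\neg\varphi$; $\varphi\wedge\psi$; $\Box\varphi$; and $\mu q\varphi$ where $q\in\mathsf{Var}$ and $\varphi$ is positive in $q$ (every free occurrence of $q$ lies under an even number of negations; $\mu q$ binds $q$). $\mathcal L_\Box^{\langle t\rangle}$-formulas: atoms; $\top$; $\neg\varphi$; $\varphi\wedge\psi$; $\Box\varphi$; and $\langle t\rangle\Delta$ for each non-empty finite set $\Delta$ of formulas. KRIPKE SEMANTICS. In a model $(W,R,h)$ with $h:\mathsf{Var}\to\wp(W)$: atoms, $\top$, Booleans as usual; $\Box\varphi$ is true at $w$ iff $\varphi$ is true at all $v$ with $Rwv$; $\langle t\rangle\Delta$ is true at $w$ iff there is an infinite sequence $w=w_0,w_1,\dots$ with $Rw_nw_{n+1}$ for all $n$ such that each $\delta\in\Delta$ is true at $w_n$ for infinitely many $n$; $\mu q\varphi$ is true at $w$ iff $w$ is in the least fixed point of the monotonic map $S\mapsto\{v\in W:(W,R,h[S/q]),v\models\varphi\}$, where $h[S/q]$ agrees with $h$ except that it sends $q$ to $S$. TOPOLOGICAL SEMANTICS. With $h:\mathsf{Var}\to\wp(X)$ and $[\![\varphi]\!]_h=\{x\in X:(X,h),x\models\varphi\}$: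 atoms, $\top$, Booleans as usual; $\Box\varphi$ is true at $x$ iff $x$ is in the interior of $[\![\varphi]\!]_h$; $\langle t\rangle\Delta$ is true at $x$ iff there is $S\subseteq X$ with $x\in S\subseteq\bigcap_{\delta\in\Delta}\mathrm{cl}([\![\delta]\!]_h\cap S)$ ($\mathrm{cl}$ = closure); $\mu q\varphi$ is true at $x$ iff $x$ is in the least fixed point of $S\mapsto[\![\varphi]\!]_{h[S/q]}$. By a theorem of Dawar and Otto, for each $\mathcal L_\Box^\mu$-formula $\varphi$ there is an $\mathcal L_\Box^{\langle t\rangle}$-formula that is equivalent to $\varphi$ in every finite transitive Kripke frame (i.e. $\varphi$ and that formula are true at the same worlds of every model on such a frame). $\varphi^t$ denotes a fixed choice of such a formula. *)

theory Defs
  imports "HOL-Analysis.Abstract_Topology" "HOL-Library.FSet"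
begin

datatype 'v mu_form =
    MAtom 'v
  | MTop
  | MNeg "'v mu_form"
  | MConj "'v mu_form" "'v mu_form"
  | MBox "'v mu_form"
  | Mu 'v "'v mu_form"

datatype 'v tangle_form =
    TAtom 'v
  | TTop
  | TNeg "'v tangle_form"
  | TConj "'v tangle_form" "'v tangle_form"
  | TBox "'v tangle_form"
  | Tangle "'v tangle_form fset"

text \<open>The number of negations above each free occurrence of \<open>q\<close>.\<close>

primrec free_neg_depths :: "'v \<Rightarrow> 'v mu_form \<Rightarrow> nat set" where
  "free_neg_depths q (MAtom p) = (if p = q then {0} else {})"
| "free_neg_depths q MTop = {}"
| "free_neg_depths q (MNeg \<phi>) = Suc ` free_neg_depths q \<phi>"
| "free_neg_depths q (MConj \<phi> \<psi>) = free_neg_depths q \<phi> \<union> free_neg_depths q \<psi>"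
| "free_neg_depths q (MBox \<phi>) = free_neg_depths q \<phi>"
| "free_neg_depths q (Mu p \<phi>) = (if p = q then {} else free_neg_depths q \<phi>)"

definition positive_in :: "'v \<Rightarrow> 'v mu_form \<Rightarrow> bool" where
  "positive_in q \<phi> \<longleftrightarrow> (\<forall>n \<in> free_neg_depths q \<phi>. even n)"

text \<open>The datatypes contain terms that are not formulas; \<open>wf_mu\<close> and \<open>wf_tangle\<close> single out
  the formulas of the two languages.\<close>

primrec wf_mu :: "'v mu_form \<Rightarrow> bool" where
  "wf_mu (MAtom p) \<longleftrightarrow> True"
| "wf_mu MTop \<longleftrightarrow> True"
| "wf_mu (MNeg \<phi>) \<longleftrightarrow> wf_mu \<phi>"
| "wf_mu (MConj \<phi> \<psi>) \<longleftrightarrow> wf_mu \<phi> \<and> wf_mu \<psi>"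
| "wf_mu (MBox \<phi>) \<longleftrightarrow> wf_mu \<phi>"
| "wf_mu (Mu q \<phi>) \<longleftrightarrow> wf_mu \<phi> \<and> positive_in q \<phi>"

primrec wf_tangle :: "'v tangle_form \<Rightarrow> bool" where
  "wf_tangle (TAtom p) \<longleftrightarrow> True"
| "wf_tangle TTop \<longleftrightarrow> True"
| "wf_tangle (TNeg \<phi>) \<longleftrightarrow> wf_tangle \<phi>"
| "wf_tangle (TConj \<phi> \<psi>) \<longleftrightarrow> wf_tangle \<phi> \<and> wf_tangle \<psi>"
| "wf_tangle (TBox \<phi>) \<longleftrightarrow> wf_tangle \<phi>"
| "wf_tangle (Tangle \<Delta>) \<longleftrightarrow> \<Delta> \<noteq> {||} \<and> (\<forall>b \<in> fset (wf_tangle |`| \<Delta>). b)"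

text \<open>Each semantic function yields the set of points of the carrier at which a formula is true.
  In the clauses for \<open>Mu\<close>, \<open>lfp\<close> is taken among all sets of the type. This is the least fixed
  point among the subsets of the carrier: truth sets lie in the carrier and, by the atom clause,
  depend only on the part of the assignment inside it.\<close>

primrec kripke_mu ::
  "'w set \<Rightarrow> ('w \<times> 'w) set \<Rightarrow> ('v \<Rightarrow> 'w set) \<Rightarrow> 'v mu_form \<Rightarrow> 'w set" where
  "kripke_mu W R h (MAtom p) = {w \<in> W. w \<in> h p}"
| "kripke_mu W R h MTop = W"
| "kripke_mu W R h (MNeg \<phi>) = W - kripke_mu W R h \<phi>"
| "kripke_mu W R h (MConj \<phi> \<psi>) = kripke_mu W R h \<phi> \<inter> kripke_mu W R h \<psi>"
| "kripke_mu W R h (MBox \<phi>) =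
     {w \<in> W. \<forall>v \<in> W. (w, v) \<in> R \<longrightarrow> v \<in> kripke_mu W R h \<phi>}"
| "kripke_mu W R h (Mu q \<phi>) = lfp (\<lambda>S. kripke_mu W R (h(q := S)) \<phi>)"

primrec kripke_tangle ::
  "'w set \<Rightarrow> ('w \<times> 'w) set \<Rightarrow> ('v \<Rightarrow> 'w set) \<Rightarrow> 'v tangle_form \<Rightarrow> 'w set" where
  "kripke_tangle W R h (TAtom p) = {w \<in> W. w \<in> h p}"
| "kripke_tangle W R h TTop = W"
| "kripke_tangle W R h (TNeg \<phi>) = W - kripke_tangle W R h \<phi>"
| "kripke_tangle W R h (TConj \<phi> \<psi>) = kripke_tangle W R h \<phi> \<inter> kripke_tangle W R h \<psi>"
| "kripke_tangle W R h (TBox \<phi>) =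
     {w \<in> W. \<forall>v \<in> W. (w, v) \<in> R \<longrightarrow> v \<in> kripke_tangle W R h \<phi>}"
| "kripke_tangle W R h (Tangle \<Delta>) =
     {w \<in> W. \<exists>s :: nat \<Rightarrow> 'w. s 0 = w \<and> (\<forall>n. s n \<in> W) \<and> (\<forall>n. (s n, s (Suc n)) \<in> R) \<and>
        (\<forall>D \<in> fset (kripke_tangle W R h |`| \<Delta>). infinite {n. s n \<in> D})}"

primrec top_mu :: "'a topology \<Rightarrow> ('v \<Rightarrow> 'a set) \<Rightarrow> 'v mu_form \<Rightarrow> 'a set" where
  "top_mu X h (MAtom p) = {x \<in> topspace X. x \<in> h p}"
| "top_mu X h MTop = topspace X"
| "top_mu X h (MNeg \<phi>) = topspace X - top_mu X h \<phi>"
| "top_mu X h (MConj \<phi> \<psi>) = top_mu X h \<phi> \<inter> top_mu X h \<psi>"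
| "top_mu X h (MBox \<phi>) = X interior_of (top_mu X h \<phi>)"
| "top_mu X h (Mu q \<phi>) = lfp (\<lambda>S. top_mu X (h(q := S)) \<phi>)"

primrec top_tangle :: "'a topology \<Rightarrow> ('v \<Rightarrow> 'a set) \<Rightarrow> 'v tangle_form \<Rightarrow> 'a set" where
  "top_tangle X h (TAtom p) = {x \<in> topspace X. x \<in> h p}"
| "top_tangle X h TTop = topspace X"
| "top_tangle X h (TNeg \<phi>) = topspace X - top_tangle X h \<phi>"
| "top_tangle X h (TConj \<phi> \<psi>) = top_tangle X h \<phi> \<inter> top_tangle X h \<psi>"
| "top_tangle X h (TBox \<phi>) = X interior_of (top_tangle X h \<phi>)"
| "top_tangle X h (Tangle \<Delta>) =
     {x. \<exists>S. S \<subseteq> topspace X \<and> x \<in> S \<and>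
        S \<subseteq> (\<Inter>D \<in> fset (top_tangle X h |`| \<Delta>). X closure_of (D \<inter> S))}"

definition kripke_frame :: "'w set \<Rightarrow> ('w \<times> 'w) set \<Rightarrow> bool" where
  "kripke_frame W R \<longleftrightarrow> W \<noteq> {} \<and> R \<subseteq> W \<times> W"

definition equiv_in_frame ::
  "'w set \<Rightarrow> ('w \<times> 'w) set \<Rightarrow> 'v mu_form \<Rightarrow> 'v tangle_form \<Rightarrow> bool" where
  "equiv_in_frame W R \<phi> \<psi> \<longleftrightarrow>
     (\<forall>h. (\<forall>p. h p \<subseteq> W) \<longrightarrow>
        (\<forall>w \<in> W. w \<in> kripke_mu W R h \<phi> \<longleftrightarrow> w \<in> kripke_tangle W R h \<psi>))"

text \<open>\<open>\<psi>\<close> is an admissible choice for \<open>\<phi>\<close>'s translation \<open>\<phi>\<^sup>t\<close>. Every finite frame is isomorphic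
  to one whose worlds are natural numbers, so quantifying over the latter covers all finite
  transitive frames.\<close>

definition tangle_translation :: "'v mu_form \<Rightarrow> 'v tangle_form \<Rightarrow> bool" where
  "tangle_translation \<phi> \<psi> \<longleftrightarrow> wf_tangle \<psi> \<and>
     (\<forall>(W :: nat set) R. kripke_frame W R \<and> finite W \<and> trans R \<longrightarrow> equiv_in_frame W R \<phi> \<psi>)"

end

theory Submission
  imports Defs
begin

text \<open>
  The claim reduces to a finite model property: given a space, an assignment \<open>h\<close>, a point \<open>x\<close>, a
  fixpoint formula \<open>\<phi>\<close> and a tangle formula \<open>\<theta>\<close>, there is a finite reflexive transitive model with
  a world that agrees with \<open>x\<close> on both \<open>\<phi>\<close> and \<open>\<theta>\<close> (\<open>finite_preorder_model\<close>). If \<open>\<theta>\<close> is the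
  translation of \<open>\<phi>\<close>, the two formulas agree at that world, hence at \<open>x\<close>.

  To build the model, collect in a finite family \<open>F\<close>, closed under complement, the truth sets of the
  subformulas of \<open>\<phi>\<close> and \<open>\<theta>\<close>, where a fixpoint variable is evaluated at the fixpoint that it
  denotes. The level of a point is the set of members of \<open>F\<close> in whose closure it lies; near a given
  point levels can only shrink. The type of a point records its level and the members of \<open>F\<close>
  containing it. There are finitely many types. Call \<open>y\<close> stable if all nearby points of the same
  level have the same types in their neighbourhoods as \<open>y\<close> has. In any neighbourhood of a point, a
  point of the same level that has as few nearby types as possible is stable, so stable points are
  available everywhere (\<open>stable_dense\<close>). The worlds are the stable points, two of them being
  identified if they have the same type and the same nearby types. A world sees
  those with the same level and the same nearby types, and those of strictly smaller level
  all of whose nearby types are nearby types of the first.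

  Near a stable point \<open>y\<close>, the points of the level of \<open>y\<close> are mapped onto the cluster of \<open>y\<close> by a
  map that is locally continuous and open, while all other points form an open set of smaller levels.
  For smaller levels truth in the space and in the quotient is already known to agree, by induction,
  and on an open set a least fixed point does not depend on what happens outside. So a least fixed
  point is determined by its part on the level of \<open>y\<close>, and this part is carried along the map
  (\<open>mu_truth_at_level\<close>). Tangle formulas need a similar but simpler argument
  (\<open>tangle_operator_push\<close>).

  It remains to see that the given \<open>x\<close> can be made stable: put the singleton of \<open>x\<close> into \<open>F\<close>. A
  point of the same level as \<open>x\<close> then has \<open>x\<close> in all its neighbourhoods, and so it has every nearby
  type of \<open>x\<close>.
\<close>

section \<open>Transitive frames as topological spaces\<close>

text \<open>On a reflexive transitive frame the Kripke semantics is the topological semantics of the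
  topology of up-closed sets, so that from here on both sides are treated as spaces.\<close>

definition upset_topology :: "'w set \<Rightarrow> ('w \<times> 'w) set \<Rightarrow> 'w topology" where
  "upset_topology W R =
     topology (\<lambda>S. S \<subseteq> W \<and> (\<forall>w \<in> S. \<forall>v \<in> W. (w, v) \<in> R \<longrightarrow> v \<in> S))"

lemma openin_upset_topology:
  "openin (upset_topology W R) S \<longleftrightarrow> S \<subseteq> W \<and> (\<forall>w \<in> S. \<forall>v \<in> W. (w, v) \<in> R \<longrightarrow> v \<in> S)"
proof -
  have "istopology (\<lambda>S. S \<subseteq> W \<and> (\<forall>w \<in> S. \<forall>v \<in> W. (w, v) \<in> R \<longrightarrow> v \<in> S))"
    unfolding istopology_def by (intro conjI allI impI) (blast | force)+
  then show ?thesis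
    unfolding upset_topology_def by simp
qed

lemma topspace_upset_topology [simp]: "topspace (upset_topology W R) = W"
proof -
  have "openin (upset_topology W R) W"
    by (simp add: openin_upset_topology)
  then show ?thesis
    by (meson openin_subset openin_topspace openin_upset_topology subset_antisym)
qed

lemma interior_upset_topology:
  assumes "refl_on W R" "trans R"
  shows "upset_topology W R interior_of A = {w \<in> W. \<forall>v \<in> W. (w, v) \<in> R \<longrightarrow> v \<in> A}"
    (is "_ = ?I")
proof
  show "upset_topology W R interior_of A \<subseteq> ?I"
    by (auto simp: interior_of_def openin_upset_topology)
  have "openin (upset_topology W R) ?I"
    using \<open>trans R\<close> by (auto simp: openin_upset_topology dest: transD)
  moreover have "?I \<subseteq> A"
    using \<open>refl_on W R\<close> by (auto simp: refl_on_def)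
  ultimately show "?I \<subseteq> upset_topology W R interior_of A"
    by (rule interior_of_maximal[rotated])
qed

lemma closure_upset_topology:
  assumes "refl_on W R" "trans R"
  shows "upset_topology W R closure_of A = {w \<in> W. \<exists>v \<in> W \<inter> A. (w, v) \<in> R}"
  unfolding closure_of_interior_of interior_upset_topology[OF assms] by auto

lemma kripke_mu_eq_top_mu:
  assumes "refl_on W R" "trans R"
  shows "kripke_mu W R h \<phi> = top_mu (upset_topology W R) h \<phi>"
  by (induction \<phi> arbitrary: h) (simp_all add: interior_upset_topology[OF assms])

text \<open>The range of a path that meets each \<open>\<delta>\<close> infinitely often is a set \<open>S\<close> as in the topological
  clause, since from every point of the path a later point of each \<open>\<delta>\<close> is accessible. Conversely,
  from a point of \<open>S\<close> one walks inside \<open>S\<close> to the members of \<open>\<Delta>\<close>, taking each in turn infinitely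
  often.\<close>

lemma kripke_tangle_eq_top_tangle:
  assumes "refl_on W R" "trans R"
  shows "kripke_tangle W R h \<theta> = top_tangle (upset_topology W R) h \<theta>"
proof (induction \<theta>)
  case (Tangle \<Delta>)
  let ?Y = "upset_topology W R"
  let ?ds = "top_tangle ?Y h ` fset \<Delta>"
  have eq: "kripke_tangle W R h ` fset \<Delta> = ?ds"
    by (rule image_cong[OF refl]) (rule Tangle.IH)
  have "(\<exists>s :: nat \<Rightarrow> 'a. s 0 = w \<and> (\<forall>n. s n \<in> W) \<and> (\<forall>n. (s n, s (Suc n)) \<in> R) \<and>
            (\<forall>D \<in> ?ds. infinite {n. s n \<in> D})) \<longleftrightarrow>
        (\<exists>S. S \<subseteq> W \<and> w \<in> S \<and> S \<subseteq> (\<Inter>D \<in> ?ds. ?Y closure_of (D \<inter> S)))"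
    (is "?path \<longleftrightarrow> ?set") for w
  proof
    assume ?path
    then obtain s :: "nat \<Rightarrow> 'a" where s: "s 0 = w" "\<forall>n. s n \<in> W" "\<forall>n. (s n, s (Suc n)) \<in> R"
      "\<forall>D \<in> ?ds. infinite {n. s n \<in> D}"
      by (elim exE conjE) (rule that)
    have step: "(s n, s (n + k)) \<in> R" for n k
    proof (induction k)
      case 0
      show ?case using s(2) assms(1) by (simp add: refl_on_def)
    next
      case (Suc k)
      then show ?case using s(3)[rule_format, of "n + k"] transD[OF assms(2), of "s n" "s (n + k)"] by simp
    qed
    have "s n \<in> ?Y closure_of (D \<inter> range s)" if D: "D \<in> ?ds" for n D
    proof -
      obtain m where "m \<ge> n" "s m \<in> D"
        using s(4)[rule_format, OF D] by (auto simp: infinite_nat_iff_unbounded_le)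
      then show ?thesis
        using step[of n "m - n"] s(2) by (auto simp: closure_upset_topology[OF assms])
    qed
    then show ?set
      using s(1,2) by (intro exI[of _ "range s"]) auto
  next
    assume ?set
    then obtain S where S: "S \<subseteq> W" "w \<in> S"
      "\<And>D. D \<in> ?ds \<Longrightarrow> S \<subseteq> ?Y closure_of (D \<inter> S)"
      by (elim exE conjE) (rule that, (assumption | blast)+)
    show ?path
    proof (cases "?ds = {}")
      case True
      then show ?thesis
        using S assms(1) by (intro exI[of _ "\<lambda>_. w"]) (auto simp: refl_on_def)
    next
      case False
      \<comment> \<open>A schedule of targets: decoding the step number as a pair makes every target recur.\<close>
      obtain e :: "nat \<Rightarrow> 'a set" where e: "range e = ?ds" "\<And>D. D \<in> ?ds \<Longrightarrow> infinite {n. e n = D}"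
      proof -
        define e where "e n = from_nat_into ?ds (fst (prod_decode n))" for n
        have "e n \<in> ?ds" for n
          using False by (simp add: e_def from_nat_into)
        moreover have "infinite {n. e n = D}" if D: "D \<in> ?ds" for D
        proof -
          obtain i where i: "from_nat_into ?ds i = D"
            using from_nat_into_surj[OF countable_finite D] by auto
          have "range (\<lambda>k. prod_encode (i, k)) \<subseteq> {n. e n = D}"
            using i by (auto simp: e_def)
          moreover have "infinite (range (\<lambda>k. prod_encode (i, k)))"
            by (intro range_inj_infinite injI) (metis prod_encode_eq prod.inject)
          ultimately show ?thesis
            using infinite_super by blast
        qed
        moreover from this have "?ds \<subseteq> range e"
          by (metis (mono_tags, lifting) empty_Collect_eq finite.emptyI rangeI subsetI)
        ultimately show thesis
          by (intro that[of e]) auto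
      qed
      have "\<forall>n. \<forall>v \<in> S. \<exists>u \<in> S. u \<in> e n \<and> (v, u) \<in> R"
      proof (intro allI ballI)
        fix n v assume "v \<in> S"
        then have "v \<in> ?Y closure_of (e n \<inter> S)"
          using S(3)[of "e n"] e(1) by blast
        then show "\<exists>u \<in> S. u \<in> e n \<and> (v, u) \<in> R"
          by (auto simp: closure_upset_topology[OF assms])
      qed
      then obtain f where f: "\<And>n v. v \<in> S \<Longrightarrow> f n v \<in> S \<and> f n v \<in> e n \<and> (v, f n v) \<in> R"
        by metis
      define s where "s = rec_nat w f"
      have sS: "s n \<in> S" for n
        by (induction n) (use S(2) f in \<open>auto simp: s_def\<close>)
      have "infinite {n. s n \<in> D}" if "D \<in> ?ds" for D
      proof -
        have "Suc ` {n. e n = D} \<subseteq> {n. s n \<in> D}"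
          using f sS by (auto simp: s_def)
        moreover have "infinite (Suc ` {n. e n = D})"
          using e(2)[OF that] by (simp add: finite_image_iff)
        ultimately show ?thesis
          using infinite_super by blast
      qed
      moreover have "(s n, s (Suc n)) \<in> R" for n
        using f[OF sS[of n]] by (simp add: s_def)
      moreover have "s 0 = w"
        by (simp add: s_def)
      ultimately show ?thesis
        using sS S(1) by (intro exI[of _ s]) auto
    qed
  qed
  then show ?case
    using eq by auto
qed (simp_all add: interior_upset_topology[OF assms])

section \<open>Monotonicity and locality of the topological semantics\<close>

lemma top_mu_subset_topspace: "wf_mu \<phi> \<Longrightarrow> top_mu X h \<phi> \<subseteq> topspace X"
proof (induction \<phi> arbitrary: h)
  case (Mu q \<phi>)
  then show ?case
    by (auto intro!: lfp_lowerbound)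
qed (auto dest: subsetD[OF interior_of_subset_topspace])

lemma top_tangle_subset_topspace: "top_tangle X h \<theta> \<subseteq> topspace X"
  by (induction \<theta>) (auto dest: subsetD[OF interior_of_subset_topspace])

text \<open>The induction must treat both polarities at once, because negation exchanges them.\<close>

lemma top_mu_polarity:
  assumes "S \<subseteq> T"
  shows "((\<forall>n \<in> free_neg_depths q \<phi>. even n) \<longrightarrow>
            top_mu X (h(q := S)) \<phi> \<subseteq> top_mu X (h(q := T)) \<phi>) \<and>
         ((\<forall>n \<in> free_neg_depths q \<phi>. odd n) \<longrightarrow>
            top_mu X (h(q := T)) \<phi> \<subseteq> top_mu X (h(q := S)) \<phi>)"
proof (induction \<phi> arbitrary: h)
  case (MAtom p)
  then show ?case using assms by auto
next
  case (MNeg \<phi>)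
  then show ?case by (auto simp: ball_Un)
next
  case (MConj \<phi>1 \<phi>2)
  have "top_mu X (h(q := S)) (MConj \<phi>1 \<phi>2) \<subseteq> top_mu X (h(q := T)) (MConj \<phi>1 \<phi>2)"
    if "\<forall>n \<in> free_neg_depths q (MConj \<phi>1 \<phi>2). even n"
    using that MConj.IH[of h] unfolding top_mu.simps free_neg_depths.simps ball_Un by blast
  moreover have "top_mu X (h(q := T)) (MConj \<phi>1 \<phi>2) \<subseteq> top_mu X (h(q := S)) (MConj \<phi>1 \<phi>2)"
    if "\<forall>n \<in> free_neg_depths q (MConj \<phi>1 \<phi>2). odd n"
    using that MConj.IH[of h] unfolding top_mu.simps free_neg_depths.simps ball_Un by blast
  ultimately show ?case by blast
next
  case (MBox \<phi>)
  then show ?case by (simp add: interior_of_mono)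
next
  case (Mu p \<phi>)
  show ?case
  proof (cases "p = q")
    case False
    then have twist: "h(q := A, p := Z) = h(p := Z, q := A)" for A Z
      using fun_upd_twist by metis
    show ?thesis
      using Mu.IH False unfolding top_mu.simps twist free_neg_depths.simps if_not_P[OF False]
      by (intro conjI impI lfp_mono) blast+
  next
    case True
    show ?thesis
      unfolding top_mu.simps True fun_upd_upd by simp
  qed
qed simp

lemma mono_top_mu: "positive_in q \<phi> \<Longrightarrow> mono (\<lambda>S. top_mu X (h(q := S)) \<phi>)"
  unfolding positive_in_def by (intro monoI top_mu_polarity[THEN conjunct1, THEN mp])

lemma top_mu_unfold:
  "positive_in q \<phi> \<Longrightarrow>
     top_mu X (h(q := top_mu X h (Mu q \<phi>))) \<phi> = top_mu X h (Mu q \<phi>)"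
  using lfp_unfold[OF mono_top_mu] by fastforce

lemma top_mu_least: "top_mu X (h(q := S)) \<phi> \<subseteq> S \<Longrightarrow> top_mu X h (Mu q \<phi>) \<subseteq> S"
  by (simp add: lfp_lowerbound)

text \<open>All clauses are local on open sets. For a least fixed point, the set that is correct inside
  \<open>U\<close> and full outside \<open>U\<close> is closed under the operator, which bounds one fixed point by the other
  inside \<open>U\<close>.\<close>

lemma top_mu_local:
  assumes "openin X U" "wf_mu \<phi>"
    and "\<And>p. free_neg_depths p \<phi> \<noteq> {} \<Longrightarrow> g p \<inter> U = h p \<inter> U"
  shows "top_mu X g \<phi> \<inter> U = top_mu X h \<phi> \<inter> U"
  using assms(2,3)
proof (induction \<phi> arbitrary: g h)
  case (MAtom p)
  have "g p \<inter> U = h p \<inter> U"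
    by (rule MAtom.prems) simp
  then show ?case unfolding top_mu.simps by blast
next
  case (MNeg \<phi>)
  have "top_mu X g \<phi> \<inter> U = top_mu X h \<phi> \<inter> U"
    by (rule MNeg.IH) (use MNeg.prems in simp_all)
  then show ?case unfolding top_mu.simps by blast
next
  case (MConj \<phi>1 \<phi>2)
  have "top_mu X g \<phi>1 \<inter> U = top_mu X h \<phi>1 \<inter> U"
    by (rule MConj.IH) (use MConj.prems in simp_all)
  moreover have "top_mu X g \<phi>2 \<inter> U = top_mu X h \<phi>2 \<inter> U"
    by (rule MConj.IH) (use MConj.prems in simp_all)
  ultimately show ?case unfolding top_mu.simps by blast
next
  case (MBox \<phi>)
  have "top_mu X g \<phi> \<inter> U = top_mu X h \<phi> \<inter> U"
    by (rule MBox.IH) (use MBox.prems in simp_all)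
  then have "X interior_of (top_mu X g \<phi> \<inter> U) = X interior_of (top_mu X h \<phi> \<inter> U)" by simp
  then show ?case
    using \<open>openin X U\<close> by (simp add: interior_of_Int interior_of_openin)
next
  case (Mu q \<phi>)
  have sub: "top_mu X g (Mu q \<phi>) \<inter> U \<subseteq> top_mu X h (Mu q \<phi>)"
    if gh: "\<And>p. free_neg_depths p (Mu q \<phi>) \<noteq> {} \<Longrightarrow> g p \<inter> U = h p \<inter> U" for g h
  proof -
    let ?L = "top_mu X h (Mu q \<phi>)"
    let ?V = "?L \<union> - U"
    have "top_mu X (g(q := ?V)) \<phi> \<inter> U = top_mu X (h(q := ?L)) \<phi> \<inter> U"
    proof (rule Mu.IH)
      show "wf_mu \<phi>" using Mu.prems(1) by simp
      show "(g(q := ?V)) p \<inter> U = (h(q := ?L)) p \<inter> U" if "free_neg_depths p \<phi> \<noteq> {}" for p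
      proof (cases "p = q")
        case True
        then show ?thesis by auto
      next
        case False
        then show ?thesis using gh[of p] that by simp
      qed
    qed
    also have "\<dots> = ?L \<inter> U"
      using Mu.prems(1) by (subst top_mu_unfold) auto
    finally have "top_mu X (g(q := ?V)) \<phi> \<subseteq> ?V"
      by blast
    then have "top_mu X g (Mu q \<phi>) \<subseteq> ?V"
      by (rule top_mu_least)
    then show ?thesis by blast
  qed
  have "top_mu X g (Mu q \<phi>) \<inter> U \<subseteq> top_mu X h (Mu q \<phi>)"
    by (rule sub) (rule Mu.prems(2))
  moreover have "top_mu X h (Mu q \<phi>) \<inter> U \<subseteq> top_mu X g (Mu q \<phi>)"
    by (rule sub) (rule Mu.prems(2)[symmetric])
  ultimately show ?case by blast
qed simp

section \<open>Types and levels over a finite family of sets\<close>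

text \<open>Closure under complement lets interiors be treated like closures.\<close>

locale finite_family =
  fixes X :: "'a topology" and F :: "'a set set"
  assumes finite_F: "finite F"
    and F_subset: "B \<in> F \<Longrightarrow> B \<subseteq> topspace X"
    and F_complement: "B \<in> F \<Longrightarrow> topspace X - B \<in> F"
begin

text \<open>The closures to which a point belongs play the role of its true diamond formulas.\<close>

definition level :: "'a \<Rightarrow> 'a set set" where
  "level x = {B \<in> F. x \<in> X closure_of B}"

definition ptype :: "'a \<Rightarrow> 'a set set \<times> 'a set set" where
  "ptype x = ({B \<in> F. x \<in> B}, level x)"

definition near :: "'a \<Rightarrow> ('a set set \<times> 'a set set) set" where
  "near x = {s. x \<in> X closure_of {y \<in> topspace X. ptype y = s}}"

definition stable :: "'a \<Rightarrow> bool" where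
  "stable y \<longleftrightarrow> y \<in> topspace X \<and>
     (\<exists>U. openin X U \<and> y \<in> U \<and> (\<forall>z \<in> U. level z = level y \<longrightarrow> near z = near y))"

text \<open>The inclusion of levels is required to be strict so that the points seen at the same level form
  a single cluster, all of whose members have the same nearby types.\<close>

definition sees :: "'a \<Rightarrow> 'a \<Rightarrow> bool" where
  "sees y z \<longleftrightarrow> near z = near y \<and> level z = level y \<or> near z \<subseteq> near y \<and> level z \<subset> level y"

lemma finite_range_ptype: "finite (range ptype)"
proof (rule finite_subset)
  show "range ptype \<subseteq> Pow F \<times> Pow F"
    by (auto simp: ptype_def level_def)
qed (simp add: finite_F)

lemma near_subset_range: "near x \<subseteq> range ptype"
proof
  fix s assume "s \<in> near x"
  have "{y \<in> topspace X. ptype y = s} \<noteq> {}"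
  proof
    assume empty: "{y \<in> topspace X. ptype y = s} = {}"
    show False
      using \<open>s \<in> near x\<close> unfolding near_def mem_Collect_eq empty by simp
  qed
  then show "s \<in> range ptype" by auto
qed

lemma finite_near: "finite (near x)"
  using finite_subset[OF near_subset_range finite_range_ptype] .

lemma finite_level: "finite (level x)"
  by (simp add: level_def finite_F)

lemma ptype_in_near: "x \<in> topspace X \<Longrightarrow> ptype x \<in> near x"
  unfolding near_def using closure_of_subset[of "{y \<in> topspace X. ptype y = ptype x}" X] by auto

lemma same_ptype_level: "ptype x = ptype y \<Longrightarrow> level x = level y"
  by (simp add: ptype_def)

lemma same_ptype_mem: "ptype x = ptype y \<Longrightarrow> B \<in> F \<Longrightarrow> x \<in> B \<longleftrightarrow> y \<in> B"
  by (auto simp: ptype_def)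

lemma near_witness:
  assumes "s \<in> near x" "openin X U" "x \<in> U"
  obtains y where "y \<in> U" "y \<in> topspace X" "ptype y = s"
  using assms unfolding near_def in_closure_of by blast

text \<open>A member of \<open>F\<close> is a finite union of type classes, so the nearby types of a point determine its
  level.\<close>

lemma level_near: "level x = {B \<in> F. \<exists>s \<in> near x. B \<in> fst s}"
proof -
  have "x \<in> X closure_of B \<longleftrightarrow> (\<exists>s \<in> near x. B \<in> fst s)" if "B \<in> F" for B
  proof -
    let ?T = "{s \<in> range ptype. B \<in> fst s}"
    have "B = \<Union> ((\<lambda>s. {y \<in> topspace X. ptype y = s}) ` ?T)"
      using F_subset[OF that] that by (auto simp: ptype_def)
    then have "X closure_of B = X closure_of \<Union> ((\<lambda>s. {y \<in> topspace X. ptype y = s}) ` ?T)"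
      by simp
    also have "\<dots> = (\<Union>s \<in> ?T. X closure_of {y \<in> topspace X. ptype y = s})"
      using finite_range_ptype by (subst closure_of_Union) auto
    finally have "x \<in> X closure_of B \<longleftrightarrow>
        (\<exists>s \<in> ?T. x \<in> X closure_of {y \<in> topspace X. ptype y = s})"
      by blast
    then show ?thesis
      using near_subset_range[of x] unfolding near_def by blast
  qed
  then show ?thesis
    by (auto simp: level_def)
qed

lemma level_mono: "near y \<subseteq> near x \<Longrightarrow> level y \<subseteq> level x"
  unfolding level_near by blast

text \<open>Remove the closures of those finitely many type classes that \<open>x\<close> does not adhere to.\<close>

lemma near_nbhd:
  assumes "x \<in> topspace X"
  obtains U where "openin X U" "x \<in> U" "\<And>y. y \<in> U \<Longrightarrow> near y \<subseteq> near x"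
proof -
  let ?K = "\<Union> ((\<lambda>s. X closure_of {y \<in> topspace X. ptype y = s}) ` (range ptype - near x))"
  have "closedin X ?K"
    using finite_range_ptype by (intro closedin_Union) auto
  then have "openin X (topspace X - ?K)"
    by blast
  moreover have "x \<in> topspace X - ?K"
    using assms by (auto simp: near_def)
  moreover have "near y \<subseteq> near x" if "y \<in> topspace X - ?K" for y
    using that near_subset_range[of y] by (auto simp: near_def)
  ultimately show thesis
    by (rule that)
qed

lemma sees_refl: "sees y y"
  by (simp add: sees_def)

lemma sees_trans: "sees x y \<Longrightarrow> sees y z \<Longrightarrow> sees x z"
  by (auto simp: sees_def)

lemma sees_near: "sees y z \<Longrightarrow> near z \<subseteq> near y"
  by (auto simp: sees_def)

lemma stable_topspace: "stable y \<Longrightarrow> y \<in> topspace X"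
  by (simp add: stable_def)

text \<open>Among the points of the given level in a small neighbourhood, one with the fewest nearby types
  is stable: nearby types can only be lost when moving close by, and none can be lost any more.\<close>

lemma stable_dense:
  assumes "openin X U" "x \<in> U"
  obtains y where "stable y" "y \<in> U" "level y = level x" "near y \<subseteq> near x"
proof -
  have x: "x \<in> topspace X"
    using assms openin_subset by blast
  obtain N where N: "openin X N" "x \<in> N" "\<And>y. y \<in> N \<Longrightarrow> near y \<subseteq> near x"
    using near_nbhd[OF x] by blast
  obtain y where y: "y \<in> U \<inter> N \<and> level y = level x"
    and min: "\<And>z. z \<in> U \<inter> N \<and> level z = level x \<Longrightarrow> card (near y) \<le> card (near z)"
    using ex_has_least_nat[of "\<lambda>z. z \<in> U \<inter> N \<and> level z = level x" x "\<lambda>z. card (near z)"]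
      assms N(2) by blast
  have yX: "y \<in> topspace X"
    using y N(1) openin_subset by blast
  obtain M where M: "openin X M" "y \<in> M" "\<And>z. z \<in> M \<Longrightarrow> near z \<subseteq> near y"
    using near_nbhd[OF yX] by blast
  have "near z = near y" if "z \<in> U \<inter> N \<inter> M" "level z = level y" for z
    using that y min[of z] M(3)[of z] finite_near by (intro card_seteq) auto
  moreover have "openin X (U \<inter> N \<inter> M)"
    using assms N(1) M(1) by blast
  ultimately have "stable y"
    unfolding stable_def using y yX M(2) by blast
  then show thesis
    using that y N(3) by blast
qed

text \<open>A point of the same level as \<open>x\<close> lies in the closure of the singleton of \<open>x\<close>; hence it lies in
  every closed set containing \<open>x\<close>.\<close>

lemma stable_if_singleton_in_family:
  assumes "x \<in> topspace X" "{x} \<in> F"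
  shows "stable x"
proof -
  obtain N where N: "openin X N" "x \<in> N" "\<And>y. y \<in> N \<Longrightarrow> near y \<subseteq> near x"
    using near_nbhd[OF assms(1)] by blast
  have "near z = near x" if "z \<in> N" "level z = level x" for z
  proof
    show "near z \<subseteq> near x" using N(3) that(1) .
    have "{x} \<in> level x"
      using assms closure_of_subset[of "{x}" X] by (auto simp: level_def)
    then have z: "z \<in> X closure_of {x}"
      using that(2) by (auto simp: level_def)
    show "near x \<subseteq> near z"
    proof
      fix s assume "s \<in> near x"
      then have "X closure_of {x} \<subseteq> X closure_of {y \<in> topspace X. ptype y = s}"
        by (intro closure_of_minimal) (auto simp: near_def)
      then show "s \<in> near z"
        using z by (auto simp: near_def)
    qed
  qed
  then show ?thesis
    unfolding stable_def using assms(1) N by blast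
qed

lemma stable_nbhd:
  assumes "stable y"
  obtains U where "openin X U" "y \<in> U"
    "\<And>z. z \<in> U \<Longrightarrow> near z \<subseteq> near y"
    "\<And>z. z \<in> U \<Longrightarrow> level z = level y \<Longrightarrow> stable z \<and> near z = near y"
    "\<And>z. z \<in> U \<Longrightarrow> level z = level y \<or> level z \<subset> level y"
proof -
  obtain V where V: "openin X V" "y \<in> V" "\<And>z. z \<in> V \<Longrightarrow> level z = level y \<Longrightarrow> near z = near y"
    using assms by (auto simp: stable_def)
  obtain N where N: "openin X N" "y \<in> N" "\<And>z. z \<in> N \<Longrightarrow> near z \<subseteq> near y"
    using near_nbhd[OF stable_topspace[OF assms]] by blast
  show thesis
  proof
    show "openin X (V \<inter> N)" using V N by blast
    show "y \<in> V \<inter> N" using V N by blast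
    show "near z \<subseteq> near y" if "z \<in> V \<inter> N" for z
      using that N by blast
    show "stable z \<and> near z = near y" if "z \<in> V \<inter> N" "level z = level y" for z
    proof
      have z: "z \<in> V" using that(1) by blast
      show eq: "near z = near y"
        by (rule V(3)[OF z that(2)])
      have "near w = near z" if "w \<in> V" "level w = level z" for w
        using V(3)[OF that(1)] that(2) \<open>level z = level y\<close> eq by simp
      then show "stable z"
        unfolding stable_def using V(1) z openin_subset[OF V(1)] by blast
    qed
    show "level z = level y \<or> level z \<subset> level y" if "z \<in> V \<inter> N" for z
      using level_mono[OF N(3)[of z]] that by blast
  qed
qed

lemma sees_imp_closure:
  assumes "sees y z" "z \<in> B" "B \<in> F"
  shows "y \<in> X closure_of B"
proof -
  have "ptype z \<in> near y"
    using assms F_subset[OF assms(3)] ptype_in_near sees_near by blast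
  moreover have "{x \<in> topspace X. ptype x = ptype z} \<subseteq> B"
    using same_ptype_mem[OF _ assms(3)] assms(2) by blast
  ultimately show ?thesis
    using closure_of_mono by (fastforce simp: near_def)
qed

text \<open>The point of \<open>B\<close> found near \<open>y\<close> is itself stable if it has the level of \<open>y\<close>. Otherwise it may
  be unstable; then a stable point of its level, which is smaller, still lies in the closure of \<open>B\<close>,
  and one continues from there.\<close>

lemma closure_imp_sees:
  assumes "stable y" "B \<in> F" "y \<in> X closure_of B"
  shows "\<exists>z. stable z \<and> sees y z \<and> z \<in> B"
  using assms(1,3)
proof (induction "card (level y)" arbitrary: y rule: less_induct)
  case less
  obtain U where U: "openin X U" "y \<in> U" "\<And>z. z \<in> U \<Longrightarrow> near z \<subseteq> near y"
    "\<And>z. z \<in> U \<Longrightarrow> level z = level y \<Longrightarrow> stable z \<and> near z = near y"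
    "\<And>z. z \<in> U \<Longrightarrow> level z = level y \<or> level z \<subset> level y"
    using stable_nbhd[OF less.prems(1)] by blast
  obtain z where z: "z \<in> U" "z \<in> B"
    using less.prems(2) U(1,2) unfolding in_closure_of by blast
  show ?case
  proof (cases "level z = level y")
    case True
    then show ?thesis
      using U(4)[OF z(1)] z(2) by (auto simp: sees_def)
  next
    case False
    obtain v where v: "stable v" "level v = level z" "near v \<subseteq> near z"
      using stable_dense[OF U(1) z(1)] by blast
    have lt: "level v \<subset> level y"
      using False U(5)[OF z(1)] v(2) by blast
    have "B \<in> level z"
      using z(2) \<open>B \<in> F\<close> F_subset closure_of_subset[of B X] by (auto simp: level_def)
    then have "v \<in> X closure_of B"
      using v(2) by (auto simp: level_def)
    then obtain u where "stable u" "sees v u" "u \<in> B"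
      using less.hyps[OF _ v(1)] lt psubset_card_mono[OF finite_level] by blast
    moreover have "sees y v"
      using lt v(3) U(3)[OF z(1)] by (auto simp: sees_def)
    ultimately show ?thesis
      using sees_trans by blast
  qed
qed

lemma closure_iff_sees:
  assumes "stable y" "B \<in> F"
  shows "y \<in> X closure_of B \<longleftrightarrow> (\<exists>z. stable z \<and> sees y z \<and> z \<in> B)"
  using closure_imp_sees[OF assms] sees_imp_closure[OF _ _ assms(2)] by blast

end

section \<open>The finite quotient\<close>

text \<open>The worlds are the values of \<open>c\<close>. Its codomain is left open, so that they can be chosen to be
  natural numbers.\<close>

locale finite_quotient = finite_family X F for X :: "'a topology" and F +
  fixes c :: "'a \<Rightarrow> 'w"
  assumes c_eq_iff: "stable y \<Longrightarrow> stable z \<Longrightarrow> c y = c z \<longleftrightarrow> near y = near z \<and> ptype y = ptype z"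
begin

definition worlds :: "'w set" where
  "worlds = c ` {y. stable y}"

definition acc :: "('w \<times> 'w) set" where
  "acc = {(c y, c z) | y z. stable y \<and> stable z \<and> sees y z}"

definition push :: "'a set \<Rightarrow> 'w set" where
  "push A = c ` {y \<in> A. stable y}"

abbreviation Y :: "'w topology" where
  "Y \<equiv> upset_topology worlds acc"

lemma c_in_worlds: "stable y \<Longrightarrow> c y \<in> worlds"
  by (simp add: worlds_def)

lemma acc_iff_sees:
  assumes "stable y" "stable z"
  shows "(c y, c z) \<in> acc \<longleftrightarrow> sees y z"
proof
  assume "(c y, c z) \<in> acc"
  then obtain y' z' where eq: "c y = c y'" "c z = c z'" "stable y'" "stable z'"
    and "sees y' z'"
    by (auto simp: acc_def)
  have "near y = near y'" "level y = level y'"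
    using eq assms c_eq_iff same_ptype_level by blast+
  moreover have "near z = near z'" "level z = level z'"
    using eq assms c_eq_iff same_ptype_level by blast+
  ultimately show "sees y z"
    using \<open>sees y' z'\<close> by (simp add: sees_def)
qed (use assms in \<open>auto simp: acc_def\<close>)

lemma acc_subset: "acc \<subseteq> worlds \<times> worlds"
  by (auto simp: acc_def worlds_def)

lemma refl_acc: "refl_on worlds acc"
  by (auto simp: refl_on_def worlds_def acc_iff_sees sees_refl)

lemma trans_acc: "trans acc"
proof (rule transI)
  fix u v w assume uv: "(u, v) \<in> acc" and vw: "(v, w) \<in> acc"
  have "u \<in> worlds" "v \<in> worlds" "w \<in> worlds"
    using uv vw acc_subset by blast+
  then obtain x y z where "u = c x" "v = c y" "w = c z" "stable x" "stable y" "stable z"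
    by (auto simp: worlds_def)
  then show "(u, w) \<in> acc"
    using uv vw sees_trans by (simp add: acc_iff_sees)
qed

lemma interior_Y:
  assumes "stable y"
  shows "c y \<in> Y interior_of A \<longleftrightarrow> (\<forall>v. stable v \<and> sees y v \<longrightarrow> c v \<in> A)"
proof -
  have "c y \<in> Y interior_of A \<longleftrightarrow> (\<forall>w \<in> worlds. (c y, w) \<in> acc \<longrightarrow> w \<in> A)"
    by (simp add: interior_upset_topology[OF refl_acc trans_acc] c_in_worlds assms)
  also have "\<dots> \<longleftrightarrow> (\<forall>v. stable v \<longrightarrow> (c y, c v) \<in> acc \<longrightarrow> c v \<in> A)"
    unfolding worlds_def by blast
  also have "\<dots> \<longleftrightarrow> (\<forall>v. stable v \<and> sees y v \<longrightarrow> c v \<in> A)"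
    using acc_iff_sees[OF assms] by blast
  finally show ?thesis .
qed

lemma closure_Y:
  assumes "stable y"
  shows "c y \<in> Y closure_of A \<longleftrightarrow> (\<exists>v. stable v \<and> sees y v \<and> c v \<in> A)"
proof -
  have "c y \<in> Y closure_of A \<longleftrightarrow> (\<exists>w \<in> worlds \<inter> A. (c y, w) \<in> acc)"
    by (simp add: closure_upset_topology[OF refl_acc trans_acc] c_in_worlds assms)
  also have "\<dots> \<longleftrightarrow> (\<exists>v. stable v \<and> c v \<in> A \<and> (c y, c v) \<in> acc)"
    unfolding worlds_def by blast
  also have "\<dots> \<longleftrightarrow> (\<exists>v. stable v \<and> sees y v \<and> c v \<in> A)"
    using acc_iff_sees[OF assms] by blast
  finally show ?thesis .
qed

lemma push_subset: "push A \<subseteq> worlds"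
  by (auto simp: push_def worlds_def)

lemma push_iff:
  assumes "A \<inter> topspace X \<in> F" "stable y"
  shows "c y \<in> push A \<longleftrightarrow> y \<in> A"
proof
  assume "c y \<in> push A"
  then obtain z where z: "z \<in> A" "stable z" "c y = c z"
    by (auto simp: push_def)
  then have "ptype z = ptype y"
    using assms(2) c_eq_iff by simp
  then show "y \<in> A"
    using same_ptype_mem[OF _ assms(1)] z(1) stable_topspace[OF z(2)] by blast
qed (use assms(2) in \<open>auto simp: push_def\<close>)

lemma eq_pushI:
  assumes "A' \<subseteq> worlds" "\<And>y. stable y \<Longrightarrow> c y \<in> A' \<longleftrightarrow> y \<in> A"
  shows "A' = push A"
proof
  show "A' \<subseteq> push A"
    using assms by (fastforce simp: worlds_def push_def)
  show "push A \<subseteq> A'"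
    using assms(2) by (auto simp: push_def)
qed

lemma push_iff_mem: "A \<in> F \<Longrightarrow> stable y \<Longrightarrow> c y \<in> push A \<longleftrightarrow> y \<in> A"
  using push_iff[of A y] F_subset[of A] by (simp add: Int_absorb2)

lemma interior_iff_sees:
  assumes "stable y" "A \<in> F"
  shows "y \<in> X interior_of A \<longleftrightarrow> (\<forall>v. stable v \<and> sees y v \<longrightarrow> v \<in> A)"
  using closure_iff_sees[OF assms(1) F_complement[OF assms(2)]] stable_topspace
  unfolding interior_of_closure_of by (auto simp: assms(1))

section \<open>Truth of tangle formulas in the quotient\<close>

text \<open>If \<open>y \<in> T\<close>, the image of \<open>T\<close> witnesses the tangle in the quotient, because \<open>T\<close> is itself the
  largest set of the kind that defines it. For the converse let \<open>S'\<close> be a witness in the quotient that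
  contains \<open>c y\<close>. If \<open>y\<close> sees a point of \<open>S'\<close> of smaller level, that point is in \<open>T\<close> by induction, and
  \<open>y \<in> T\<close> since \<open>T\<close> is closed. Otherwise all of \<open>S'\<close> that \<open>y\<close> sees lies in the cluster of \<open>y\<close>, every
  type of which is realised arbitrarily close to every point of that level near \<open>y\<close>; so the points
  near \<open>y\<close> that have its level and are mapped into \<open>S'\<close> by \<open>c\<close> form a witness.\<close>

lemma tangle_operator_push:
  assumes T: "T = {x. \<exists>S. S \<subseteq> topspace X \<and> x \<in> S \<and> S \<subseteq> (\<Inter>D \<in> \<D>. X closure_of (D \<inter> S))}"
    and "T \<in> F" "\<And>D. D \<in> \<D> \<Longrightarrow> D \<in> F \<and> D \<inter> T \<in> F"
    and "stable y"
  shows "(\<exists>S. S \<subseteq> worlds \<and> c y \<in> S \<and> S \<subseteq> (\<Inter>D \<in> \<D>. Y closure_of (push D \<inter> S))) \<longleftrightarrow> y \<in> T"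
proof -
  have T_dense: "T \<subseteq> X closure_of (D \<inter> T)" if D: "D \<in> \<D>" for D
  proof
    fix v assume "v \<in> T"
    then obtain S where S: "S \<subseteq> topspace X" "v \<in> S" "S \<subseteq> (\<Inter>D \<in> \<D>. X closure_of (D \<inter> S))"
      unfolding T by blast
    then have "S \<subseteq> T"
      unfolding T by blast
    then have "X closure_of (D \<inter> S) \<subseteq> X closure_of (D \<inter> T)"
      by (intro closure_of_mono Int_mono order_refl)
    then show "v \<in> X closure_of (D \<inter> T)"
      using S D by blast
  qed
  have T_closed: "X closure_of T \<subseteq> T"
  proof
    fix x assume x: "x \<in> X closure_of T"
    have "X closure_of T \<subseteq> X closure_of (D \<inter> X closure_of T)" if D: "D \<in> \<D>" for D
    proof -
      have "T \<subseteq> X closure_of T"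
        using closure_of_subset F_subset[OF \<open>T \<in> F\<close>] .
      then have "X closure_of (D \<inter> T) \<subseteq> X closure_of (D \<inter> X closure_of T)"
        by (intro closure_of_mono Int_mono order_refl)
      moreover have "X closure_of T \<subseteq> X closure_of (D \<inter> T)"
        using T_dense[OF D] by (simp add: closure_of_minimal)
      ultimately show ?thesis by blast
    qed
    then have "X closure_of T \<subseteq> (\<Inter>D \<in> \<D>. X closure_of (D \<inter> X closure_of T))"
      by blast
    then show "x \<in> T"
      using x closure_of_subset_topspace[of X T]
      by (subst T, intro CollectI exI[of _ "X closure_of T"] conjI)
  qed
  show ?thesis
  proof
    assume "\<exists>S. S \<subseteq> worlds \<and> c y \<in> S \<and> S \<subseteq> (\<Inter>D \<in> \<D>. Y closure_of (push D \<inter> S))"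
    then obtain S' where S': "S' \<subseteq> worlds" "c y \<in> S'"
      "S' \<subseteq> (\<Inter>D \<in> \<D>. Y closure_of (push D \<inter> S'))" by blast
    show "y \<in> T"
      using \<open>stable y\<close> S'(2)
    proof (induction "card (level y)" arbitrary: y rule: less_induct)
      case less
      show ?case
      proof (cases "\<exists>v. stable v \<and> sees y v \<and> level v \<subset> level y \<and> c v \<in> S'")
        case True
        then obtain v where v: "stable v" "sees y v" "level v \<subset> level y" "c v \<in> S'" by blast
        then have "v \<in> T"
          using less.hyps psubset_card_mono[OF finite_level] by blast
        then show ?thesis
          using T_closed sees_imp_closure[OF v(2) _ \<open>T \<in> F\<close>] by blast
      next
        case False
        obtain U where U: "openin X U" "y \<in> U"
          "\<And>z. z \<in> U \<Longrightarrow> level z = level y \<Longrightarrow> stable z \<and> near z = near y"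
          by (rule stable_nbhd[OF less.prems(1)]) blast
        define S where "S = {z \<in> U. level z = level y \<and> c z \<in> S'}"
        have "z \<in> X closure_of (D \<inter> S)" if z: "z \<in> S" and D: "D \<in> \<D>" for z D
          unfolding in_closure_of
        proof (intro conjI allI impI)
          have zU: "z \<in> U" "level z = level y" "c z \<in> S'"
            using z by (auto simp: S_def)
          then have zst: "stable z" "near z = near y"
            using U(3) by auto
          show "z \<in> topspace X"
            using stable_topspace zst(1) .
          fix V assume V: "z \<in> V \<and> openin X V"
          have "c z \<in> Y closure_of (push D \<inter> S')"
            using S'(3) D zU(3) by blast
          then obtain v where v: "stable v" "sees z v" "c v \<in> push D" "c v \<in> S'"
            unfolding closure_Y[OF zst(1)] by blast
          have "sees y v"
            using v(2) zU(2) zst(2) by (simp add: sees_def)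
          then have eq: "near v = near y" "level v = level y"
            using False v(1,4) by (auto simp: sees_def)
          have "ptype v \<in> near z"
            using ptype_in_near[OF stable_topspace[OF v(1)]] eq zst by simp
          moreover have "openin X (U \<inter> V)" "z \<in> U \<inter> V"
            using V U(1) zU(1) by blast+
          ultimately obtain u where u: "u \<in> U \<inter> V" "ptype u = ptype v"
            by (rule near_witness)
          then have lu: "level u = level y"
            using same_ptype_level[OF u(2)] eq(2) by simp
          then have su: "stable u" "near u = near y"
            using U(3) u(1) by blast+
          then have "c u = c v"
            using c_eq_iff[OF su(1) v(1)] u(2) eq(1) by simp
          moreover have "v \<in> D"
            using push_iff_mem[OF _ v(1)] assms(3)[OF D] v(3) by blast
          then have "u \<in> D"
            using same_ptype_mem[OF u(2)] assms(3)[OF D] by blast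
          ultimately show "\<exists>y. y \<in> D \<inter> S \<and> y \<in> V"
            using u(1) lu v(4) by (auto simp: S_def)
        qed
        then have "S \<subseteq> (\<Inter>D \<in> \<D>. X closure_of (D \<inter> S))"
          by blast
        moreover have "y \<in> S"
          using U(2) less.prems(2) by (simp add: S_def)
        moreover have "S \<subseteq> topspace X"
          using openin_subset[OF U(1)] by (auto simp: S_def)
        ultimately show ?thesis
          unfolding T by blast
      qed
    qed
  next
    assume "y \<in> T"
    have "c v \<in> Y closure_of (push D \<inter> push T)" if D: "D \<in> \<D>" and v: "stable v" "v \<in> T" for v D
    proof -
      obtain u where u: "stable u" "sees v u" "u \<in> D \<inter> T"
        using closure_imp_sees[OF v(1)] assms(3)[OF D] T_dense[OF D] v(2) by blast
      then have "c u \<in> push D \<inter> push T"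
        by (auto simp: push_def)
      then show ?thesis
        using closure_Y[OF v(1)] u by blast
    qed
    then show "\<exists>S. S \<subseteq> worlds \<and> c y \<in> S \<and> S \<subseteq> (\<Inter>D \<in> \<D>. Y closure_of (push D \<inter> S))"
      using \<open>y \<in> T\<close> \<open>stable y\<close> push_subset by (intro exI[of _ "push T"]) (auto simp: push_def)
  qed
qed

end

text \<open>Besides the truth sets of all subformulas this contains, for each tangle, the intersections of
  its truth set with those of its members: these are the sets that have to accumulate inside the
  tangle.\<close>

primrec tangle_values :: "'a topology \<Rightarrow> ('v \<Rightarrow> 'a set) \<Rightarrow> 'v tangle_form \<Rightarrow> 'a set set" where
  "tangle_values X h (TAtom p) = {top_tangle X h (TAtom p)}"
| "tangle_values X h TTop = {topspace X}"
| "tangle_values X h (TNeg \<theta>) = insert (top_tangle X h (TNeg \<theta>)) (tangle_values X h \<theta>)"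
| "tangle_values X h (TConj \<theta> \<eta>) =
     insert (top_tangle X h (TConj \<theta> \<eta>)) (tangle_values X h \<theta> \<union> tangle_values X h \<eta>)"
| "tangle_values X h (TBox \<theta>) = insert (top_tangle X h (TBox \<theta>)) (tangle_values X h \<theta>)"
| "tangle_values X h (Tangle \<Delta>) =
     insert (top_tangle X h (Tangle \<Delta>))
       ((\<lambda>D. D \<inter> top_tangle X h (Tangle \<Delta>)) ` fset (top_tangle X h |`| \<Delta>) \<union>
        \<Union> (fset (tangle_values X h |`| \<Delta>)))"

lemma finite_tangle_values: "finite (tangle_values X h \<theta>)"
  by (induction \<theta>) auto

lemma tangle_value_self: "top_tangle X h \<theta> \<in> tangle_values X h \<theta>"
  by (cases \<theta>) auto

lemma tangle_values_subset: "tangle_values X h \<theta> \<subseteq> Pow (topspace X)"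
proof -
  have self: "top_tangle X h \<eta> \<in> Pow (topspace X)" for \<eta>
    by (intro PowI top_tangle_subset_topspace)
  show ?thesis
  proof (induction \<theta>)
    case (Tangle \<Delta>)
    then show ?case
      using self[of "Tangle \<Delta>"]
      unfolding tangle_values.simps fimage.rep_eq by blast
  qed (simp_all only: tangle_values.simps insert_subset Un_subset_iff self empty_subsetI Pow_top simp_thms)
qed

context finite_quotient
begin

lemma tangle_truth:
  assumes "tangle_values X h \<theta> \<subseteq> F"
  shows "top_tangle Y (\<lambda>p. push (h p)) \<theta> = push (top_tangle X h \<theta>)"
  using assms
proof (induction \<theta>)
  case (TAtom p)
  have "h p \<inter> topspace X \<in> F"
    using TAtom by (simp add: Collect_conj_eq Int_commute)
  then show ?case
    by (intro eq_pushI) (auto simp: push_iff c_in_worlds stable_topspace)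
next
  case TTop
  show ?case
    by (intro eq_pushI) (auto simp: c_in_worlds stable_topspace)
next
  case (TNeg \<theta>)
  then have "top_tangle X h \<theta> \<in> F"
    using tangle_value_self[of X h \<theta>] by auto
  then show ?case
    using TNeg by (intro eq_pushI) (auto simp: c_in_worlds stable_topspace push_iff_mem)
next
  case (TConj \<theta> \<eta>)
  then have "top_tangle X h \<theta> \<in> F" "top_tangle X h \<eta> \<in> F"
    using tangle_value_self[of X h \<theta>] tangle_value_self[of X h \<eta>] by auto
  moreover have "top_tangle Y (\<lambda>p. push (h p)) \<theta> = push (top_tangle X h \<theta>)"
    "top_tangle Y (\<lambda>p. push (h p)) \<eta> = push (top_tangle X h \<eta>)"
    using TConj by auto
  ultimately show ?case
    using push_subset unfolding top_tangle.simps by (intro eq_pushI) (auto simp: push_iff_mem)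
next
  case (TBox \<theta>)
  then have mem: "top_tangle X h \<theta> \<in> F"
    using tangle_value_self[of X h \<theta>] by auto
  have IH: "top_tangle Y (\<lambda>p. push (h p)) \<theta> = push (top_tangle X h \<theta>)"
    using TBox by simp
  show ?case
    unfolding top_tangle.simps IH
  proof (rule eq_pushI)
    show "Y interior_of push (top_tangle X h \<theta>) \<subseteq> worlds"
      using interior_of_subset_topspace[of Y] by simp
    show "c y \<in> Y interior_of push (top_tangle X h \<theta>) \<longleftrightarrow> y \<in> X interior_of top_tangle X h \<theta>"
      if "stable y" for y
      unfolding interior_Y[OF that] interior_iff_sees[OF that mem] using push_iff_mem[OF mem] by blast
  qed
next
  case (Tangle \<Delta>)
  let ?\<D> = "top_tangle X h ` fset \<Delta>"
  have vals: "tangle_values X h \<delta> \<subseteq> F" if "\<delta> \<in> fset \<Delta>" for \<delta>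
    using Tangle.prems that by auto
  have "top_tangle Y (\<lambda>p. push (h p)) ` fset \<Delta> = (\<lambda>\<delta>. push (top_tangle X h \<delta>)) ` fset \<Delta>"
    by (rule image_cong[OF refl]) (use Tangle.IH vals in blast)
  then have img: "top_tangle Y (\<lambda>p. push (h p)) ` fset \<Delta> = push ` ?\<D>"
    by (simp add: image_image)
  have T: "top_tangle X h (Tangle \<Delta>) = {x. \<exists>S. S \<subseteq> topspace X \<and> x \<in> S \<and>
        S \<subseteq> (\<Inter>D \<in> ?\<D>. X closure_of (D \<inter> S))}"
    by simp
  have mem: "top_tangle X h (Tangle \<Delta>) \<in> F"
    using Tangle.prems tangle_value_self by blast
  have mems: "D \<in> F \<and> D \<inter> top_tangle X h (Tangle \<Delta>) \<in> F" if "D \<in> ?\<D>" for D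
  proof
    show "D \<in> F"
      using that vals tangle_value_self by blast
    show "D \<inter> top_tangle X h (Tangle \<Delta>) \<in> F"
      using that Tangle.prems unfolding tangle_values.simps fimage.rep_eq by blast
  qed
  show ?case
  proof (rule eq_pushI)
    show "top_tangle Y (\<lambda>p. push (h p)) (Tangle \<Delta>) \<subseteq> worlds"
      by (rule order_trans[OF top_tangle_subset_topspace]) simp
    show "c y \<in> top_tangle Y (\<lambda>p. push (h p)) (Tangle \<Delta>) \<longleftrightarrow> y \<in> top_tangle X h (Tangle \<Delta>)"
      if "stable y" for y
      using tangle_operator_push[OF T mem mems that]
      unfolding top_tangle.simps(6)[of Y] fimage.rep_eq img mem_Collect_eq topspace_upset_topology INT_simps
      by simp
  qed
qed

end

section \<open>Truth of fixpoint formulas in the quotient\<close>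

text \<open>Below a binder the variable is assigned the fixpoint it stands for, not
  an approximation of it. This keeps the family finite.\<close>

primrec mu_values :: "'a topology \<Rightarrow> ('v \<Rightarrow> 'a set) \<Rightarrow> 'v mu_form \<Rightarrow> 'a set set" where
  "mu_values X h (MAtom p) = {top_mu X h (MAtom p)}"
| "mu_values X h MTop = {topspace X}"
| "mu_values X h (MNeg \<phi>) = insert (top_mu X h (MNeg \<phi>)) (mu_values X h \<phi>)"
| "mu_values X h (MConj \<phi> \<psi>) =
     insert (top_mu X h (MConj \<phi> \<psi>)) (mu_values X h \<phi> \<union> mu_values X h \<psi>)"
| "mu_values X h (MBox \<phi>) = insert (top_mu X h (MBox \<phi>)) (mu_values X h \<phi>)"
| "mu_values X h (Mu q \<phi>) =
     insert (top_mu X h (Mu q \<phi>)) (mu_values X (h(q := top_mu X h (Mu q \<phi>))) \<phi>)"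

lemma finite_mu_values: "finite (mu_values X h \<phi>)"
  by (induction \<phi> arbitrary: h) auto

lemma mu_value_self: "top_mu X h \<phi> \<in> mu_values X h \<phi>"
  by (cases \<phi>) auto

lemma mu_values_subset: "wf_mu \<phi> \<Longrightarrow> mu_values X h \<phi> \<subseteq> Pow (topspace X)"
proof (induction \<phi> arbitrary: h)
  case (MBox \<phi>)
  then show ?case
    using top_mu_subset_topspace[of "MBox \<phi>" X h] by auto
next
  case (Mu q \<phi>)
  then show ?case
    using top_mu_subset_topspace[of "Mu q \<phi>" X h] by auto
qed (auto dest: subsetD[OF top_mu_subset_topspace])

lemma free_atom_mu_value:
  "free_neg_depths p \<phi> \<noteq> {} \<Longrightarrow> h p \<inter> topspace X \<in> mu_values X h \<phi>"
proof (induction \<phi> arbitrary: h)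
  case (MAtom q)
  then show ?case by (auto split: if_splits)
next
  case (Mu q \<phi>)
  then have "p \<noteq> q" "free_neg_depths p \<phi> \<noteq> {}"
    by (auto split: if_splits)
  let ?h = "h(q := top_mu X h (Mu q \<phi>))"
  have "?h p \<inter> topspace X \<in> mu_values X ?h \<phi>"
    by (rule Mu.IH) fact
  moreover have "?h p = h p"
    using \<open>p \<noteq> q\<close> by simp
  ultimately show ?case
    unfolding mu_values.simps by simp
qed auto

context finite_quotient
begin

definition level_below :: "'a \<Rightarrow> 'w set" where
  "level_below y = c ` {v. stable v \<and> sees y v \<and> level v \<subset> level y}"

lemma openin_level_below:
  assumes "stable y"
  shows "openin Y (level_below y)"
  unfolding openin_upset_topology
proof (intro conjI ballI impI)
  show "level_below y \<subseteq> worlds"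
    by (auto simp: level_below_def worlds_def)
  fix w w' assume "w \<in> level_below y" "w' \<in> worlds" "(w, w') \<in> acc"
  then obtain v u where v: "stable v" "sees y v" "level v \<subset> level y" "w = c v"
    and u: "stable u" "w' = c u"
    by (auto simp: level_below_def worlds_def)
  then have "sees v u"
    using \<open>(w, w') \<in> acc\<close> acc_iff_sees by simp
  then have "sees y u" "level u \<subset> level y"
    using v sees_trans by (blast, auto simp: sees_def)
  then show "w' \<in> level_below y"
    using u by (auto simp: level_below_def)
qed

lemma openin_lower_levels:
  assumes "openin X U"
  shows "openin X {z \<in> U. level z \<subset> E}"
proof (subst openin_subopen, intro ballI)
  fix z assume z: "z \<in> {z \<in> U. level z \<subset> E}"
  obtain N where N: "openin X N" "z \<in> N" "\<And>y. y \<in> N \<Longrightarrow> near y \<subseteq> near z"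
    using near_nbhd[of z] z openin_subset[OF assms] by blast
  have "N \<inter> U \<subseteq> {z \<in> U. level z \<subset> E}"
    using level_mono[OF N(3)] z by blast
  then show "\<exists>T. openin X T \<and> z \<in> T \<and> T \<subseteq> {z \<in> U. level z \<subset> E}"
    using N(1,2) assms z by (intro exI[of _ "N \<inter> U"]) auto
qed

text \<open>The neighbourhood \<open>U\<close> of \<open>y\<close> splits into the points \<open>Z\<close> of the level of \<open>y\<close> and the open set \<open>B\<close>
  of points of smaller level. The formula is evaluated under assignments \<open>g\<close> and \<open>g'\<close> that are
  arbitrary on \<open>Z\<close> and on the cluster of \<open>y\<close>, apart from corresponding to each other along \<open>c\<close>, while
  on the smaller levels they agree with the reference assignment \<open>h\<close> for which the truth lemma is
  already known. This is the generality that an induction on the formula needs: for a fixpoint,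
  \<open>h\<close> is updated by the fixpoint under \<open>h\<close>, whose part on the smaller levels is also the part of the
  fixpoints under \<open>g\<close> and \<open>g'\<close>, and only the parts on \<open>Z\<close> and on the cluster are still to be compared.\<close>

lemma mu_truth_at_level:
  fixes \<sigma> :: "'v mu_form"
  assumes "stable y" and U: "openin X U"
    and U_near: "\<And>z. z \<in> U \<Longrightarrow> near z \<subseteq> near y"
    and U_stable: "\<And>z. z \<in> U \<Longrightarrow> level z = level y \<Longrightarrow> stable z \<and> near z = near y"
    and U_level: "\<And>z. z \<in> U \<Longrightarrow> level z = level y \<or> level z \<subset> level y"
    and IH: "\<And>(\<sigma> :: 'v mu_form) h v. wf_mu \<sigma> \<Longrightarrow> mu_values X h \<sigma> \<subseteq> F \<Longrightarrow> stable v \<Longrightarrow>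
      level v \<subset> level y \<Longrightarrow> c v \<in> top_mu Y (\<lambda>p. push (h p)) \<sigma> \<longleftrightarrow> v \<in> top_mu X h \<sigma>"
    and "wf_mu \<sigma>" "mu_values X h \<sigma> \<subseteq> F"
    and "\<And>p. free_neg_depths p \<sigma> \<noteq> {} \<Longrightarrow>
           g p \<inter> {z \<in> U. level z \<subset> level y} = h p \<inter> {z \<in> U. level z \<subset> level y}"
    and "\<And>p. free_neg_depths p \<sigma> \<noteq> {} \<Longrightarrow>
           g' p \<inter> level_below y = push (h p) \<inter> level_below y"
    and "\<And>p z. free_neg_depths p \<sigma> \<noteq> {} \<Longrightarrow> z \<in> U \<Longrightarrow> level z = level y \<Longrightarrow>
           z \<in> g p \<longleftrightarrow> c z \<in> g' p"
    and "z \<in> U" "level z = level y"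
  shows "z \<in> top_mu X g \<sigma> \<longleftrightarrow> c z \<in> top_mu Y g' \<sigma>"
proof -
  define Z where "Z = {z \<in> U. level z = level y}"
  define B where "B = {z \<in> U. level z \<subset> level y}"
  define agree where "agree \<sigma> h g g' \<longleftrightarrow>
    (\<forall>p. free_neg_depths p \<sigma> \<noteq> {} \<longrightarrow> g p \<inter> B = h p \<inter> B \<and>
         g' p \<inter> level_below y = push (h p) \<inter> level_below y \<and>
         (\<forall>z \<in> Z. z \<in> g p \<longleftrightarrow> c z \<in> g' p))"
    for \<sigma> :: "'v mu_form" and h g :: "'v \<Rightarrow> 'a set" and g' :: "'v \<Rightarrow> 'w set"
  have openB: "openin X B"
    unfolding B_def using openin_lower_levels[OF U] .
  have UZB: "U = Z \<union> B" and ZB: "Z \<inter> B = {}"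
    using U_level by (auto simp: Z_def B_def)
  have Z: "stable z" "near z = near y" "level z = level y" if "z \<in> Z" for z
    using that U_stable by (auto simp: Z_def)
  have local_X: "top_mu X g \<sigma> \<inter> B = top_mu X h \<sigma> \<inter> B"
    if "wf_mu \<sigma>" "agree \<sigma> h g g'" for \<sigma> h g g'
    by (rule top_mu_local[OF openB that(1)]) (use that(2) in \<open>simp add: agree_def\<close>)
  have local_Y: "top_mu Y g' \<sigma> \<inter> level_below y = top_mu Y (\<lambda>p. push (h p)) \<sigma> \<inter> level_below y"
    if "wf_mu \<sigma>" "agree \<sigma> h g g'" for \<sigma> h g g'
    by (rule top_mu_local[OF openin_level_below[OF assms(1)] that(1)])
      (use that(2) in \<open>simp add: agree_def\<close>)
  have below: "c v \<in> top_mu Y g' \<sigma> \<longleftrightarrow> v \<in> top_mu X h \<sigma>"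
    if "wf_mu \<sigma>" "mu_values X h \<sigma> \<subseteq> F" "agree \<sigma> h g g'"
      and v: "stable v" "sees y v" "level v \<subset> level y" for \<sigma> h g g' v
  proof -
    have "c v \<in> level_below y"
      using v by (auto simp: level_below_def)
    then have "c v \<in> top_mu Y g' \<sigma> \<longleftrightarrow> c v \<in> top_mu Y (\<lambda>p. push (h p)) \<sigma>"
      using local_Y[OF that(1,3)] by blast
    also have "\<dots> \<longleftrightarrow> v \<in> top_mu X h \<sigma>"
      by (rule IH) fact+
    finally show ?thesis .
  qed
  have "\<forall>z \<in> Z. z \<in> top_mu X g \<sigma> \<longleftrightarrow> c z \<in> top_mu Y g' \<sigma>"
    if "wf_mu \<sigma>" "mu_values X h \<sigma> \<subseteq> F" "agree \<sigma> h g g'" for \<sigma> h g g'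
    using that
  proof (induction \<sigma> arbitrary: h g g')
    case (MAtom p)
    then show ?case
      using Z(1) stable_topspace c_in_worlds by (simp add: agree_def)
  next
    case MTop
    then show ?case
      using Z(1) stable_topspace c_in_worlds by simp
  next
    case (MNeg \<sigma>)
    then have "\<forall>z \<in> Z. z \<in> top_mu X g \<sigma> \<longleftrightarrow> c z \<in> top_mu Y g' \<sigma>"
      by (intro MNeg.IH) (auto simp: agree_def)
    then show ?case
      using Z(1) stable_topspace c_in_worlds by simp
  next
    case (MConj \<sigma> \<tau>)
    have "\<forall>z \<in> Z. z \<in> top_mu X g \<sigma> \<longleftrightarrow> c z \<in> top_mu Y g' \<sigma>"
      by (rule MConj.IH) (use MConj.prems in \<open>auto simp: agree_def\<close>)
    moreover have "\<forall>z \<in> Z. z \<in> top_mu X g \<tau> \<longleftrightarrow> c z \<in> top_mu Y g' \<tau>"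
      by (rule MConj.IH) (use MConj.prems in \<open>auto simp: agree_def\<close>)
    ultimately show ?case by simp
  next
    case (MBox \<sigma>)
    have prems: "wf_mu \<sigma>" "mu_values X h \<sigma> \<subseteq> F" "agree \<sigma> h g g'"
      using MBox.prems by (auto simp: agree_def)
    have at_Z: "z \<in> top_mu X g \<sigma> \<longleftrightarrow> c z \<in> top_mu Y g' \<sigma>" if "z \<in> Z" for z
      using MBox.IH[OF prems] that by blast
    have at_B: "z \<in> top_mu X g \<sigma> \<longleftrightarrow> z \<in> top_mu X h \<sigma>" if "z \<in> B" for z
      using local_X[OF prems(1,3)] that by blast
    have mem: "top_mu X h \<sigma> \<in> F"
      using mu_value_self prems(2) by blast
    show ?case
      unfolding top_mu.simps
    proof
      fix z assume "z \<in> Z"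
      have zU: "z \<in> U" using \<open>z \<in> Z\<close> by (simp add: Z_def)
      show "z \<in> X interior_of top_mu X g \<sigma> \<longleftrightarrow> c z \<in> Y interior_of top_mu Y g' \<sigma>"
        unfolding interior_Y[OF Z(1)[OF \<open>z \<in> Z\<close>]]
      proof (intro iffI allI impI)
        fix v assume int: "z \<in> X interior_of top_mu X g \<sigma>" and v: "stable v \<and> sees z v"
        \<comment> \<open>The type of a seen point \<open>v\<close> is realised near \<open>z\<close>, inside the interior.\<close>
        have "ptype v \<in> near z"
          using v ptype_in_near stable_topspace sees_near by blast
        moreover have "openin X (U \<inter> X interior_of top_mu X g \<sigma>)"
          using U by (intro openin_Int openin_interior_of)
        ultimately obtain z' where z': "z' \<in> U \<inter> X interior_of top_mu X g \<sigma>" "ptype z' = ptype v"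
          by (rule near_witness) (use int zU in blast)
        have z'T: "z' \<in> top_mu X g \<sigma>"
          using z'(1) interior_of_subset[of X] by blast
        have lev: "level z' = level v"
          using same_ptype_level[OF z'(2)] .
        have yv: "sees y v"
          using v Z[OF \<open>z \<in> Z\<close>] by (simp add: sees_def)
        show "c v \<in> top_mu Y g' \<sigma>"
        proof (cases "level v = level y")
          case True
          then have "z' \<in> Z" and "near v = near y"
            using z'(1) lev yv by (auto simp: Z_def sees_def)
          then have "c z' = c v"
            using c_eq_iff Z z'(2) v by simp
          then show ?thesis
            using at_Z[OF \<open>z' \<in> Z\<close>] z'T by simp
        next
          case False
          then have low: "level v \<subset> level y"
            using yv by (auto simp: sees_def)
          then have "z' \<in> B"
            using z'(1) lev by (simp add: B_def)
          then have "v \<in> top_mu X h \<sigma>"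
            using at_B z'T same_ptype_mem[OF z'(2) mem] by blast
          then show ?thesis
            using below[OF prems _ yv low] v by blast
        qed
      next
        assume box: "\<forall>v. stable v \<and> sees z v \<longrightarrow> c v \<in> top_mu Y g' \<sigma>"
        \<comment> \<open>A counterexample in \<open>B\<close> need not be stable, but it leads to a stable one seen by \<open>z\<close>.\<close>
        have "U \<subseteq> top_mu X g \<sigma>"
        proof
          fix z' assume "z' \<in> U"
          then consider "z' \<in> Z" | "z' \<in> B" using UZB by blast
          then show "z' \<in> top_mu X g \<sigma>"
          proof cases
            case 1
            then have "sees z z'"
              using Z \<open>z \<in> Z\<close> by (simp add: sees_def)
            then show ?thesis
              using box Z(1)[OF 1] at_Z[OF 1] by blast
          next
            case 2
            show ?thesis
            proof (rule ccontr)
              assume "z' \<notin> top_mu X g \<sigma>"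
              then have no: "z' \<in> topspace X - top_mu X h \<sigma>"
                using at_B[OF 2] openin_subset[OF U] \<open>z' \<in> U\<close> by blast
              have memc: "topspace X - top_mu X h \<sigma> \<in> F"
                using F_complement[OF mem] .
              obtain u where u: "stable u" "u \<in> U" "level u = level z'" "near u \<subseteq> near z'"
                using stable_dense[OF U \<open>z' \<in> U\<close>] by blast
              have "topspace X - top_mu X h \<sigma> \<in> level z'"
                using no memc closure_of_subset[of "topspace X - top_mu X h \<sigma>" X]
                by (auto simp: level_def)
              then have "u \<in> X closure_of (topspace X - top_mu X h \<sigma>)"
                using u(3) by (auto simp: level_def)
              then obtain v where v: "stable v" "sees u v" "v \<in> topspace X - top_mu X h \<sigma>"
                using closure_imp_sees[OF u(1) memc] by blast
              have yu: "sees y u" "level u \<subset> level y"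
                using 2 u(3,4) U_near[OF \<open>z' \<in> U\<close>] by (auto simp: sees_def B_def)
              then have yv: "sees y v" "level v \<subset> level y"
                using v(2) sees_trans by (blast, auto simp: sees_def)
              then have "sees z v"
                using Z[OF \<open>z \<in> Z\<close>] by (simp add: sees_def)
              then have "c v \<in> top_mu Y g' \<sigma>"
                using box v(1) by blast
              then show False
                using below[OF prems v(1) yv] v(3) by blast
            qed
          qed
        qed
        then show "z \<in> X interior_of top_mu X g \<sigma>"
          using interior_of_maximal[OF _ U] zU by blast
      qed
    qed
  next
    case (Mu q \<sigma>)
    let ?L = "top_mu X h (Mu q \<sigma>)"
    let ?G = "top_mu X g (Mu q \<sigma>)"
    let ?G' = "top_mu Y g' (Mu q \<sigma>)"
    let ?h = "h(q := ?L)"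
    have wf: "wf_mu \<sigma>" and pos: "positive_in q \<sigma>" and vals: "mu_values X ?h \<sigma> \<subseteq> F"
      and mem: "?L \<in> F"
      using Mu.prems by auto
    have G_B: "?G \<inter> B = ?L \<inter> B"
      by (rule local_X[OF Mu.prems(1,3)])
    have G'_low: "?G' \<inter> level_below y = push ?L \<inter> level_below y"
    proof -
      have "c v \<in> ?G' \<longleftrightarrow> c v \<in> push ?L" if "stable v" "sees y v" "level v \<subset> level y" for v
        using below[OF Mu.prems that] push_iff_mem[OF mem that(1)] by blast
      then show ?thesis
        unfolding level_below_def by blast
    qed
    have agree_upd: "agree \<sigma> ?h (g(q := S)) (g'(q := S'))"
      if "S \<inter> B = ?L \<inter> B" "S' \<inter> level_below y = ?G' \<inter> level_below y"
        "\<And>z. z \<in> Z \<Longrightarrow> z \<in> S \<longleftrightarrow> c z \<in> S'" for S S'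
      unfolding agree_def
    proof (intro allI impI)
      fix p assume free: "free_neg_depths p \<sigma> \<noteq> {}"
      show "(g(q := S)) p \<inter> B = ?h p \<inter> B \<and>
        (g'(q := S')) p \<inter> level_below y = push (?h p) \<inter> level_below y \<and>
        (\<forall>z \<in> Z. z \<in> (g(q := S)) p \<longleftrightarrow> c z \<in> (g'(q := S')) p)"
      proof (cases "p = q")
        case True
        then show ?thesis
          using that G'_low by (simp del: top_mu.simps)
      next
        case False
        then have "free_neg_depths p (Mu q \<sigma>) \<noteq> {}"
          using free by simp
        then show ?thesis
          using Mu.prems(3) False unfolding agree_def by (simp del: top_mu.simps)
      qed
    qed
    note IH = Mu.IH[OF wf vals agree_upd, rule_format]
    have unfold_L: "top_mu X ?h \<sigma> = ?L"
      using top_mu_unfold[OF pos] .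
    show ?case
    proof (intro ballI iffI)
      fix z assume "z \<in> Z" "z \<in> ?G"
      \<comment> \<open>The pullback of the fixpoint of the quotient, made full outside \<open>U\<close>, is closed under the
        operator of the space.\<close>
      define S where "S = (?L \<inter> B) \<union> {z \<in> Z. c z \<in> ?G'} \<union> - U"
      have S: "S \<inter> B = ?L \<inter> B" "\<And>z. z \<in> Z \<Longrightarrow> z \<in> S \<longleftrightarrow> c z \<in> ?G'"
        using ZB UZB unfolding S_def by blast+
      have "top_mu X (g(q := S)) \<sigma> \<subseteq> S"
      proof
        fix w assume w: "w \<in> top_mu X (g(q := S)) \<sigma>"
        consider "w \<in> Z" | "w \<in> B" | "w \<notin> U" using UZB by blast
        then show "w \<in> S"
        proof cases
          case 1
          have "c w \<in> top_mu Y (g'(q := ?G')) \<sigma>"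
            using IH[OF S(1) refl S(2) 1] w by (rule iffD1)
          then have "c w \<in> ?G'"
            unfolding top_mu_unfold[OF pos] .
          then show ?thesis
            using S(2)[OF 1] by (rule iffD2[rotated])
        next
          case 2
          have "top_mu X (g(q := S)) \<sigma> \<inter> B = top_mu X ?h \<sigma> \<inter> B"
            by (rule local_X[OF wf agree_upd[OF S(1) refl S(2)]])
          then show ?thesis
            using w 2 unfold_L S(1) by blast
        next
          case 3
          then show ?thesis by (simp add: S_def)
        qed
      qed
      then have "?G \<subseteq> S"
        by (rule top_mu_least)
      then show "c z \<in> ?G'"
        using \<open>z \<in> Z\<close> \<open>z \<in> ?G\<close> S(2) by blast
    next
      fix z assume "z \<in> Z" "c z \<in> ?G'"
      \<comment> \<open>The part of \<open>?G\<close> in \<open>Z\<close> need not be a union of fibres of \<open>c\<close>. So take those worlds whose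
        whole fibre in \<open>Z\<close> lies in \<open>?G\<close>; monotonicity shows that they are closed under the operator of
        the quotient.\<close>
      define S' where "S' = {w. (w \<in> level_below y \<longrightarrow> w \<in> ?G') \<and> (\<forall>z \<in> Z. c z = w \<longrightarrow> z \<in> ?G)}"
      define S where "S = (?L \<inter> B) \<union> {z \<in> Z. c z \<in> S'}"
      have "c z \<notin> level_below y" if "z \<in> Z" for z
      proof
        assume "c z \<in> level_below y"
        then obtain v where v: "stable v" "level v \<subset> level y" "c z = c v"
          by (auto simp: level_below_def)
        then have "level z = level v"
          using c_eq_iff[OF Z(1)[OF that] v(1)] same_ptype_level by blast
        then show False
          using v(2) Z(3)[OF that] by blast
      qed
      then have S'_low: "S' \<inter> level_below y = ?G' \<inter> level_below y"
        unfolding S'_def by blast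
      have S: "S \<inter> B = ?L \<inter> B" "\<And>z. z \<in> Z \<Longrightarrow> z \<in> S \<longleftrightarrow> c z \<in> S'"
        using ZB unfolding S_def by blast+
      have "S \<subseteq> ?G"
        using G_B unfolding S_def S'_def by blast
      have "top_mu Y (g'(q := S')) \<sigma> \<subseteq> S'"
      proof
        fix w assume w: "w \<in> top_mu Y (g'(q := S')) \<sigma>"
        have "w \<in> ?G'" if "w \<in> level_below y"
        proof -
          have "top_mu Y (g'(q := S')) \<sigma> \<inter> level_below y =
              top_mu Y (g'(q := ?G')) \<sigma> \<inter> level_below y"
            by (rule top_mu_local[OF openin_level_below[OF assms(1)] wf])
              (use S'_low in \<open>simp del: top_mu.simps\<close>)
          then have "w \<in> top_mu Y (g'(q := ?G')) \<sigma>"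
            using w that by blast
          then show ?thesis
            unfolding top_mu_unfold[OF pos] .
        qed
        moreover have "u \<in> ?G" if "u \<in> Z" "c u = w" for u
        proof -
          have "c u \<in> top_mu Y (g'(q := S')) \<sigma>"
            using w that(2) by simp
          with IH[OF S(1) S'_low S(2) that(1)] have "u \<in> top_mu X (g(q := S)) \<sigma>"
            by (rule iffD2)
          also have "\<dots> \<subseteq> top_mu X (g(q := ?G)) \<sigma>"
            using monoD[OF mono_top_mu[OF pos] \<open>S \<subseteq> ?G\<close>] .
          also have "\<dots> = ?G"
            by (rule top_mu_unfold[OF pos])
          finally show ?thesis .
        qed
        ultimately show "w \<in> S'"
          unfolding S'_def by blast
      qed
      then have "?G' \<subseteq> S'"
        by (rule top_mu_least)
      then show "z \<in> ?G"
        using \<open>z \<in> Z\<close> \<open>c z \<in> ?G'\<close> unfolding S'_def by blast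
    qed
  qed
  moreover have "agree \<sigma> h g g'"
    using assms(9-11) by (auto simp: agree_def Z_def B_def)
  ultimately show ?thesis
    using assms(7,8,12,13) by (auto simp: Z_def)
qed

lemma mu_truth:
  fixes \<sigma> :: "'v mu_form"
  assumes "wf_mu \<sigma>" "mu_values X h \<sigma> \<subseteq> F" "stable y"
  shows "c y \<in> top_mu Y (\<lambda>p. push (h p)) \<sigma> \<longleftrightarrow> y \<in> top_mu X h \<sigma>"
  using assms
proof (induction "card (level y)" arbitrary: y \<sigma> h rule: less_induct)
  case less
  obtain U where U: "openin X U" "y \<in> U" "\<And>z. z \<in> U \<Longrightarrow> near z \<subseteq> near y"
    "\<And>z. z \<in> U \<Longrightarrow> level z = level y \<Longrightarrow> stable z \<and> near z = near y"
    "\<And>z. z \<in> U \<Longrightarrow> level z = level y \<or> level z \<subset> level y"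
    by (rule stable_nbhd[OF less.prems(3)]) blast
  have "y \<in> top_mu X h \<sigma> \<longleftrightarrow> c y \<in> top_mu Y (\<lambda>p. push (h p)) \<sigma>"
  proof (rule mu_truth_at_level[OF less.prems(3) U(1,3,4,5) _ less.prems(1,2) refl refl _ U(2) refl])
    show "c v \<in> top_mu Y (\<lambda>p. push (h p)) \<sigma> \<longleftrightarrow> v \<in> top_mu X h \<sigma>"
      if "wf_mu \<sigma>" "mu_values X h \<sigma> \<subseteq> F" "stable v" "level v \<subset> level y"
      for \<sigma> :: "'v mu_form" and h v
      by (rule less.hyps[OF psubset_card_mono[OF finite_level that(4)] that(1-3)])
    show "z \<in> h p \<longleftrightarrow> c z \<in> push (h p)"
      if "free_neg_depths p \<sigma> \<noteq> {}" "z \<in> U" "level z = level y" for p z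
      using push_iff[of "h p" z] free_atom_mu_value[OF that(1)] less.prems(2) U(4)[OF that(2,3)]
      by blast
  qed
  then show ?case by blast
qed

end

section \<open>Finite models and the translation\<close>

text \<open>The quotient for the family generated by both formulas and the singleton of \<open>x\<close>.\<close>

lemma finite_preorder_model:
  fixes \<phi> :: "'v mu_form" and \<theta> :: "'v tangle_form"
  assumes "wf_mu \<phi>" "x \<in> topspace X"
  obtains W :: "nat set" and R h' w where "kripke_frame W R" "finite W" "trans R" "\<And>p. h' p \<subseteq> W"
    "w \<in> W" "w \<in> kripke_mu W R h' \<phi> \<longleftrightarrow> x \<in> top_mu X h \<phi>"
    "w \<in> kripke_tangle W R h' \<theta> \<longleftrightarrow> x \<in> top_tangle X h \<theta>"
proof -
  define F0 where "F0 = insert {x} (mu_values X h \<phi> \<union> tangle_values X h \<theta>)"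
  define F where "F = F0 \<union> (\<lambda>B. topspace X - B) ` F0"
  have F0: "finite F0" "F0 \<subseteq> Pow (topspace X)"
    using assms mu_values_subset[OF assms(1), of X h] tangle_values_subset[of X h \<theta>]
    by (auto simp: F0_def finite_mu_values finite_tangle_values)
  interpret finite_family X F
  proof
    show "finite F"
      using F0(1) by (simp add: F_def)
    show "B \<subseteq> topspace X" if "B \<in> F" for B
      using that F0(2) by (auto simp: F_def)
    show "topspace X - B \<in> F" if B: "B \<in> F" for B
    proof (cases "B \<in> F0")
      case False
      then obtain C where C: "C \<in> F0" "B = topspace X - C"
        using B unfolding F_def by blast
      then have "topspace X - B = C"
        using F0(2) by blast
      then show ?thesis
        using C(1) by (simp add: F_def)
    qed (simp add: F_def)
  qed
  define key where "key y = (near y, ptype y)" for y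
  have finite_keys: "finite (key ` {y. stable y})"
  proof (rule finite_subset)
    show "key ` {y. stable y} \<subseteq> Pow (range ptype) \<times> range ptype"
      using near_subset_range by (auto simp: key_def)
  qed (simp add: finite_range_ptype)
  obtain f :: "_ \<Rightarrow> nat" and n where f: "inj_on f (key ` {y. stable y})"
    using finite_imp_inj_to_nat_seg[OF finite_keys] by (elim exE conjE)
  define c where "c y = f (key y)" for y
  interpret finite_quotient X F c
  proof
    show "c y = c z \<longleftrightarrow> near y = near z \<and> ptype y = ptype z" if "stable y" "stable z" for y z
    proof -
      have "f (key y) = f (key z) \<longleftrightarrow> key y = key z"
        using inj_on_eq_iff[OF f] that by blast
      then show ?thesis
        by (simp add: c_def key_def)
    qed
  qed
  have stable: "stable x"
    by (rule stable_if_singleton_in_family[OF assms(2)]) (simp add: F_def F0_def)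
  show thesis
  proof
    show "kripke_frame worlds acc"
      using acc_subset c_in_worlds[OF stable] by (auto simp: kripke_frame_def)
    show "finite worlds"
      using finite_keys by (simp add: worlds_def c_def flip: image_image)
    show "trans acc" by (rule trans_acc)
    show "push (h p) \<subseteq> worlds" for p by (rule push_subset)
    show "c x \<in> worlds" by (rule c_in_worlds[OF stable])
    have "mu_values X h \<phi> \<subseteq> F"
      by (auto simp: F_def F0_def)
    then show "c x \<in> kripke_mu worlds acc (\<lambda>p. push (h p)) \<phi> \<longleftrightarrow> x \<in> top_mu X h \<phi>"
      unfolding kripke_mu_eq_top_mu[OF refl_acc trans_acc] by (rule mu_truth[OF assms(1) _ stable])
    have vals: "tangle_values X h \<theta> \<subseteq> F"
      by (auto simp: F_def F0_def)
    then have "top_tangle X h \<theta> \<in> F"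
      using tangle_value_self by blast
    then show "c x \<in> kripke_tangle worlds acc (\<lambda>p. push (h p)) \<theta> \<longleftrightarrow> x \<in> top_tangle X h \<theta>"
      unfolding kripke_tangle_eq_top_tangle[OF refl_acc trans_acc] tangle_truth[OF vals]
      by (rule push_iff_mem[OF _ stable])
  qed
qed

theorem corollary6p8:
  fixes \<phi> :: "'v mu_form" and \<phi>t :: "'v tangle_form"
    and X :: "'a topology" and h :: "'v \<Rightarrow> 'a set" and x :: 'a
  assumes "infinite (UNIV :: 'v set)"
    and "wf_mu \<phi>"
    and "tangle_translation \<phi> \<phi>t"
    and "\<forall>p. h p \<subseteq> topspace X"
    and "x \<in> topspace X"
  shows "x \<in> top_mu X h \<phi> \<longleftrightarrow> x \<in> top_tangle X h \<phi>t"
proof -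
  obtain W :: "nat set" and R h' w where W: "kripke_frame W R" "finite W" "trans R"
    "\<And>p. h' p \<subseteq> W" "w \<in> W"
    and truth: "w \<in> kripke_mu W R h' \<phi> \<longleftrightarrow> x \<in> top_mu X h \<phi>"
      "w \<in> kripke_tangle W R h' \<phi>t \<longleftrightarrow> x \<in> top_tangle X h \<phi>t"
    by (rule finite_preorder_model[OF assms(2,5), where h = h and \<theta> = \<phi>t]) (rule that)
  have "equiv_in_frame W R \<phi> \<phi>t"
    using assms(3) W(1-3) by (simp add: tangle_translation_def)
  then have "w \<in> kripke_mu W R h' \<phi> \<longleftrightarrow> w \<in> kripke_tangle W R h' \<phi>t"
    using W(4,5) by (simp add: equiv_in_frame_def)
  then show ?thesis
    using truth by blast
qed

end
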